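(* Let $m\ge 3$. For 2 players and $m$ cakes, each cut into 3 pieces, there exist preferences for the two players, satisfying the assumptions described in the context, such that for no division $x$ are there disjoint piece selections $s_A\in\mathrm{Pref}_A(x)$ and $s_B\in\mathrm{Pref}_B(x)$. That is, a division with disjoint envy-free piece selections need not exist.
   Context: Model of multi-cake division. There are $m$ cakes, each of length $1$, and each cake is cut into $k$ pieces (here $k=3$). A division is an $m\times k$ matrix $x=(x_{ij})$ with $x_{ij}\ge 0$ and $\sum_{j} x_{ij}=1$ for every $i$; $x_{ij}$ is the length of the $j$-th piece of cake $i$. A piece selection is a map $s:\{1,\dots,m\}\to\{1,\dots,k\}$ choosing one piece from each cake. Two piece selections $s,s'$ are disjoint if $s(i)\ne s'(i)$ for every cake $i$. Each player (here $A$, $B$) has preferences given by assigning to every division $x$ a nonempty set $\mathrm{Pref}(x)$ of preferred piece selections (those not worse than any other at $x$ for that player); each player's preferences depend only on that player. Assumptions: (hungry) no $s\in\mathrm{Pref}(x)$ contains an empty piece, i.e. $x_{i,s(i)}>0$ for all $i$ (a player prefers a nonempty piece in a cake to an empty piece in that cake, other cakes fixed); (closed) for each piece selection $s$ the set of divisions $x$ with $s\in\mathrm{Pref}(x)$ is closed. *)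

theory Defs
  imports "HOL-Analysis.Analysis"
begin

text \<open>
  Cakes are indexed by the finite type \<open>'m\<close> and the pieces of each cake by the finite type
  \<open>'k\<close>, so \<open>x $ i $ j\<close> is the length of piece \<open>j\<close> of cake \<open>i\<close>, and \<open>('m, 'k) selection\<close>
  consists of all maps from cakes to pieces.
\<close>

type_synonym ('m, 'k) division = "real ^ 'k ^ 'm"
type_synonym ('m, 'k) selection = "'m \<Rightarrow> 'k"

definition divisions :: "('m::finite, 'k::finite) division set" where
  "divisions = {x. (\<forall>i j. 0 \<le> x $ i $ j) \<and> (\<forall>i. (\<Sum>j\<in>UNIV. x $ i $ j) = 1)}"

definition disjoint_selections :: "('m, 'k) selection \<Rightarrow> ('m, 'k) selection \<Rightarrow> bool" where
  "disjoint_selections s s' \<longleftrightarrow> (\<forall>i. s i \<noteq> s' i)"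

text \<open>
  A player's preferences are a function from divisions to sets of piece selections; its values
  outside \<open>divisions\<close> are irrelevant and unconstrained. Since \<open>divisions\<close> is a closed subset of
  the ambient Euclidean space, \<open>closed\<close> below agrees with closedness relative to \<open>divisions\<close>.
\<close>

type_synonym ('m, 'k) preferences = "('m, 'k) division \<Rightarrow> ('m, 'k) selection set"

definition hungry :: "('m::finite, 'k::finite) preferences \<Rightarrow> bool" where
  "hungry Pref \<longleftrightarrow> (\<forall>x\<in>divisions. \<forall>s\<in>Pref x. \<forall>i. 0 < x $ i $ s i)"

definition closed_preferences :: "('m::finite, 'k::finite) preferences \<Rightarrow> bool" where
  "closed_preferences Pref \<longleftrightarrow> (\<forall>s. closed {x \<in> divisions. s \<in> Pref x})"

definition admissible_preferences :: "('m::finite, 'k::finite) preferences \<Rightarrow> bool" where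
  "admissible_preferences Pref \<longleftrightarrow>
     (\<forall>x\<in>divisions. Pref x \<noteq> {}) \<and> hungry Pref \<and> closed_preferences Pref"

end

theory Submission
  imports Defs
begin

text \<open>
  Place the three pieces of every cake from left to right on \<open>[0, 1]\<close>. Player \<open>B\<close> likes a
  selection if the intervals of its pieces share an interval of length at least
  \<open>\<delta> = (1/3)\<^sup>m\<close>; successively restricting to the best third shows that there is one. Player
  \<open>A\<close> likes a selection if its pieces have length at least \<open>\<delta>/2\<close> and every disjoint
  selection has common overlap at most \<open>\<delta>/2\<close>; so no disjoint pair is liked.

  With three cakes \<open>A\<close> always finds such a selection. Let \<open>a\<close> and \<open>b\<close> be the two cut
  positions of a cake. Take the left piece of the cake \<open>i\<close> with the largest \<open>a\<close>, and
  from the remaining two cakes \<open>j\<close>, \<open>k\<close> with \<open>b\<^sub>j \<le> b\<^sub>k\<close> the right piece of \<open>j\<close> and the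
  middle piece of \<open>k\<close>. These pieces cover \<open>[0, 1]\<close>, so the pieces of a disjoint selection have
  no common overlap of positive length. Chosen pieces that are too short are replaced by
  arbitrary long ones, which spoils the covering only by short intervals.
\<close>

text \<open>In type \<open>3\<close> the numeral \<open>3\<close> equals \<open>0\<close>, so the
  left-to-right order of the pieces is fixed by cases instead of by the order of the type.\<close>

definition left_end :: "real ^ 3 \<Rightarrow> 3 \<Rightarrow> real" where
  "left_end y j = (if j = 1 then 0 else if j = 2 then y $ 1 else y $ 1 + y $ 2)"

definition right_end :: "real ^ 3 \<Rightarrow> 3 \<Rightarrow> real" where
  "right_end y j = left_end y j + y $ j"

lemma left_end_simps [simp]:
  "left_end y 1 = 0" "left_end y 2 = y $ 1" "left_end y 3 = y $ 1 + y $ 2"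
  by (simp_all add: left_end_def)

lemma right_end_simps [simp]:
  "right_end y 1 = y $ 1" "right_end y 2 = y $ 1 + y $ 2"
  "right_end y 3 = y $ 1 + y $ 2 + y $ 3"
  by (simp_all add: right_end_def)

lemma continuous_on_left_end [continuous_intros]:
  "continuous_on S f \<Longrightarrow> continuous_on S (\<lambda>x. left_end (f x) j)"
  unfolding left_end_def
  by (cases "j = 1"; cases "j = 2") (simp_all add: continuous_intros)

lemma continuous_on_right_end [continuous_intros]:
  "continuous_on S f \<Longrightarrow> continuous_on S (\<lambda>x. right_end (f x) j)"
  unfolding right_end_def by (intro continuous_intros)

lemma divisionsD:
  fixes x :: "('m::finite, 3) division"
  assumes "x \<in> divisions"
  shows "0 \<le> x $ i $ j" and "x $ i $ 1 + x $ i $ 2 + x $ i $ 3 = 1"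
  using assms by (auto simp: divisions_def sum_3)

lemma closed_divisions: "closed (divisions :: ('m::finite, 'k::finite) division set)"
  unfolding divisions_def
  by (intro closed_Collect_conj closed_Collect_all closed_Collect_le closed_Collect_eq
      continuous_intros)

text \<open>The three pieces cover \<open>[l, h]\<close>, so their intersections with it have total
  length \<open>h - l\<close>, and the longest gets at least a third of that.\<close>

lemma third_of_interval:
  fixes l h :: real
  assumes "0 \<le> l" "l \<le> h" "\<And>j. 0 \<le> y $ j" "h \<le> y $ 1 + y $ 2 + y $ 3"
  shows "\<exists>j. (h - l) / 3 \<le> min h (right_end y j) - max l (left_end y j)"
proof (rule ccontr)
  assume "\<not> ?thesis"
  then have "min h (right_end y j) - max l (left_end y j) < (h - l) / 3" for j
    by (simp add: not_le)
  from this[of 1] this[of 2] this[of 3] show False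
    using assms(1,2,4) assms(3)[of 1] assms(3)[of 2] assms(3)[of 3]
    by (simp add: min_def max_def split: if_splits)
qed

text \<open>Passing to an arbitrary set \<open>I\<close> of cakes allows adding one cake at a time,
  each at the cost of a factor 3.\<close>

lemma common_interval:
  fixes x :: "('m::finite, 3) division"
  assumes "x \<in> divisions" "finite I"
  shows "\<exists>s l h. 0 \<le> l \<and> h \<le> 1 \<and> (1 / 3) ^ card I \<le> h - l \<and>
           (\<forall>i\<in>I. left_end (x $ i) (s i) \<le> l \<and> h \<le> right_end (x $ i) (s i))"
  using assms(2)
proof (induction I rule: finite_induct)
  case empty
  show ?case by (intro exI[of _ "\<lambda>_. 1"] exI[of _ 0] exI[of _ 1]) auto
next
  case (insert c I)
  then obtain s l h where
    lh: "0 \<le> l" "h \<le> 1" "(1 / 3) ^ card I \<le> h - l" and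
    s: "\<And>i. i \<in> I \<Longrightarrow> left_end (x $ i) (s i) \<le> l \<and> h \<le> right_end (x $ i) (s i)"
    by blast
  have "0 \<le> (1 / 3 :: real) ^ card I" by simp
  then have "l \<le> h" using lh(3) by linarith
  obtain j where j: "(h - l) / 3 \<le> min h (right_end (x $ c) j) - max l (left_end (x $ c) j)"
    using third_of_interval[of l h "x $ c"] lh \<open>l \<le> h\<close> divisionsD[OF assms(1), of c] by auto
  show ?case
  proof (intro exI conjI ballI)
    show "0 \<le> max l (left_end (x $ c) j)" "min h (right_end (x $ c) j) \<le> 1"
      using lh by auto
    show "(1 / 3) ^ card (insert c I) \<le> min h (right_end (x $ c) j) - max l (left_end (x $ c) j)"
      using j lh insert.hyps by simp
    fix i assume "i \<in> insert c I"
    then show "left_end (x $ i) ((s(c := j)) i) \<le> max l (left_end (x $ c) j)"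
      and "min h (right_end (x $ c) j) \<le> right_end (x $ i) ((s(c := j)) i)"
      using s by (auto simp: le_max_iff_disj min_le_iff_disj)
  qed
qed

lemma three_distinct_elements:
  assumes "CARD('a::finite) \<ge> 3"
  obtains p q r :: "'a::finite" where "p \<noteq> q" "p \<noteq> r" "q \<noteq> r"
proof -
  obtain T :: "'a set" where "card T = 3"
    using obtain_subset_with_card_n[OF assms] by metis
  then show thesis using that by (auto simp: card_3_iff)
qed

text \<open>For cut positions \<open>a\<close> and \<open>b\<close>, the two inequalities say that
  \<open>[0, a i]\<close>, \<open>[a k, b k]\<close> and \<open>[b j, 1]\<close> leave no gap in
  \<open>[0, 1]\<close>.\<close>

lemma covering_order:
  fixes a b :: "'a::finite \<Rightarrow> real"
  assumes "CARD('a) \<ge> 3"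
  obtains i j k where "i \<noteq> j" "i \<noteq> k" "j \<noteq> k" "a k \<le> a i" "b j \<le> b k"
proof -
  obtain p q r :: 'a where d: "p \<noteq> q" "p \<noteq> r" "q \<noteq> r"
    using three_distinct_elements[OF assms] .
  note outer = that
  \<comment> \<open>Here \<open>u\<close> maximises \<open>a\<close> and becomes \<open>i\<close>;
    comparing \<open>b v\<close> with \<open>b w\<close> decides which of \<open>v\<close>,
    \<open>w\<close> is \<open>j\<close>.\<close>
  have *: thesis if "u \<noteq> v" "u \<noteq> w" "v \<noteq> w" "a v \<le> a u" "a w \<le> a u" for u v w
    using that outer[of u v w] outer[of u w v] by (cases "b v \<le> b w") auto
  consider "a q \<le> a p \<and> a r \<le> a p" | "a p \<le> a q \<and> a r \<le> a q" | "a p \<le> a r \<and> a q \<le> a r"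
    by linarith
  then show thesis
    using d *[of p q r] *[of q p r] *[of r p q] by cases auto
qed

lemma covering_selection:
  fixes x :: "('m::finite, 3) division"
  assumes "CARD('m) \<ge> 3" "x \<in> divisions"
  shows "\<exists>t. \<forall>s. disjoint_selections t s \<longrightarrow>
               (\<exists>i j. right_end (x $ i) (s i) \<le> left_end (x $ j) (s j))"
proof -
  obtain i j k where d: "i \<noteq> j" "i \<noteq> k" "j \<noteq> k"
    and a: "x $ k $ 1 \<le> x $ i $ 1"
    and b: "x $ j $ 1 + x $ j $ 2 \<le> x $ k $ 1 + x $ k $ 2"
    using covering_order[OF assms(1), of "\<lambda>c. x $ c $ 1" "\<lambda>c. x $ c $ 1 + x $ c $ 2"]
    by blast
  \<comment> \<open>The value 2 is meant for \<open>k\<close>; on cakes other than \<open>i\<close>,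
    \<open>j\<close>, \<open>k\<close> it is an arbitrary default.\<close>
  define t :: "'m \<Rightarrow> 3" where "t = (\<lambda>c. if c = i then 1 else if c = j then 3 else 2)"
  show ?thesis
  proof (intro exI[of _ t] allI impI)
    fix s assume "disjoint_selections t s"
    then have "t i \<noteq> s i" "t j \<noteq> s j" "t k \<noteq> s k"
      unfolding disjoint_selections_def by blast+
    then have ne: "s i \<noteq> 1" "s j \<noteq> 3" "s k \<noteq> 2"
      using d by (auto simp: t_def)
    have li: "x $ i $ 1 \<le> left_end (x $ i) (s i)"
      using ne divisionsD(1)[OF assms(2), of i 2] exhaust_3[of "s i"] by auto
    have rj: "right_end (x $ j) (s j) \<le> x $ j $ 1 + x $ j $ 2"
      using ne divisionsD(1)[OF assms(2), of j 2] exhaust_3[of "s j"] by auto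
    \<comment> \<open>In cake \<open>k\<close> the piece of \<open>s\<close> ends at the first cut,
      hence before the piece in \<open>i\<close> starts, or begins at the second cut, hence after
      the piece in \<open>j\<close> ends.\<close>
    consider "s k = 1" | "s k = 3" using ne exhaust_3[of "s k"] by auto
    then show "\<exists>i j. right_end (x $ i) (s i) \<le> left_end (x $ j) (s j)"
    proof cases
      case 1
      then have "right_end (x $ k) (s k) \<le> left_end (x $ i) (s i)" using a li by simp
      then show ?thesis by blast
    next
      case 2
      then have "right_end (x $ j) (s j) \<le> left_end (x $ k) (s k)" using b rj by simp
      then show ?thesis by blast
    qed
  qed
qed

lemma covering_selection_long_pieces:
  fixes x :: "('m::finite, 3) division"
  assumes "CARD('m) \<ge> 3" "x \<in> divisions" "0 \<le> \<epsilon>" "\<epsilon> \<le> 1 / 3"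
  shows "\<exists>t. (\<forall>i. \<epsilon> \<le> x $ i $ t i) \<and>
             (\<forall>s. disjoint_selections t s \<longrightarrow>
               (\<exists>i j. right_end (x $ i) (s i) - left_end (x $ j) (s j) \<le> \<epsilon>))"
proof -
  obtain t where t: "\<And>s. disjoint_selections t s \<Longrightarrow>
      \<exists>i j. right_end (x $ i) (s i) \<le> left_end (x $ j) (s j)"
    using covering_selection[OF assms(1,2)] by blast
  have "\<exists>j. \<epsilon> \<le> x $ i $ j" for i
  proof (rule ccontr)
    assume "\<not> ?thesis"
    then have "x $ i $ j < \<epsilon>" for j by (simp add: not_le)
    from this[of 1] this[of 2] this[of 3] show False
      using divisionsD(2)[OF assms(2), of i] assms(4) by linarith
  qed
  then obtain g where g: "\<And>i. \<epsilon> \<le> x $ i $ g i" by metis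
  define t' where "t' = (\<lambda>i. if \<epsilon> \<le> x $ i $ t i then t i else g i)"
  show ?thesis
  proof (intro exI[of _ t'] conjI allI impI)
    show "\<epsilon> \<le> x $ i $ t' i" for i using g by (simp add: t'_def)
    fix s assume disj: "disjoint_selections t' s"
    show "\<exists>i j. right_end (x $ i) (s i) - left_end (x $ j) (s j) \<le> \<epsilon>"
    proof (cases "disjoint_selections t s")
      case True
      then show ?thesis using t[OF True] assms(3) by (metis diff_le_0_iff_le order_trans)
    next
      case False
      \<comment> \<open>Where \<open>s\<close> meets \<open>t\<close> but not \<open>t'\<close>, the
        piece was replaced for being too short, and its length bounds the common overlap of
        \<open>s\<close>.\<close>
      then obtain i where "t i = s i" by (auto simp: disjoint_selections_def)
      moreover have "t' i \<noteq> s i" using disj by (simp add: disjoint_selections_def)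
      ultimately have "x $ i $ s i \<le> \<epsilon>" by (auto simp: t'_def split: if_splits)
      then have "right_end (x $ i) (s i) - left_end (x $ i) (s i) \<le> \<epsilon>"
        by (simp add: right_end_def)
      then show ?thesis by blast
    qed
  qed
qed

text \<open>The common overlap is the least right end minus the greatest left end. Ranging over all
  pairs of cakes expresses a lower bound on it by closed conditions; the pairs with
  \<open>i = j\<close> yield hunger.\<close>

definition overlap_pref :: "real \<Rightarrow> ('m::finite, 3) preferences" where
  "overlap_pref \<delta> x = {s. \<forall>i j. \<delta> \<le> right_end (x $ i) (s i) - left_end (x $ j) (s j)}"

text \<open>The uniform bound \<open>\<epsilon>\<close> on the lengths gives hunger by a closed
  condition, which mere positivity would not be.\<close>

definition blocking_pref :: "real \<Rightarrow> ('m::finite, 3) preferences" where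
  "blocking_pref \<epsilon> x = {t. (\<forall>i. \<epsilon> \<le> x $ i $ t i) \<and>
     (\<forall>s. disjoint_selections t s \<longrightarrow>
       (\<exists>i j. right_end (x $ i) (s i) - left_end (x $ j) (s j) \<le> \<epsilon>))}"

lemma admissible_overlap_pref:
  assumes "0 < \<delta>" "\<delta> \<le> (1 / 3) ^ CARD('m)"
  shows "admissible_preferences (overlap_pref \<delta> :: ('m::finite, 3) preferences)"
  unfolding admissible_preferences_def
proof (intro conjI ballI)
  fix x :: "('m, 3) division" assume x: "x \<in> divisions"
  obtain s l h where "(1 / 3) ^ CARD('m) \<le> h - l"
    and s: "\<And>i. left_end (x $ i) (s i) \<le> l \<and> h \<le> right_end (x $ i) (s i)"
    using common_interval[OF x, of UNIV] by auto
  then have "\<delta> \<le> right_end (x $ i) (s i) - left_end (x $ j) (s j)" for i j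
    using assms(2) s[of i] s[of j] by linarith
  then show "overlap_pref \<delta> x \<noteq> {}" unfolding overlap_pref_def by blast
next
  show "hungry (overlap_pref \<delta> :: ('m, 3) preferences)"
    unfolding hungry_def
  proof (intro ballI allI)
    fix x :: "('m, 3) division" and s i assume "s \<in> overlap_pref \<delta> x"
    then have "\<delta> \<le> right_end (x $ i) (s i) - left_end (x $ i) (s i)"
      unfolding overlap_pref_def by blast
    then show "0 < x $ i $ s i" using assms(1) by (simp add: right_end_def)
  qed
next
  have "closed {x :: ('m, 3) division. s \<in> overlap_pref \<delta> x}" for s
    unfolding overlap_pref_def mem_Collect_eq
    by (intro closed_Collect_all closed_Collect_le continuous_intros)
  then show "closed_preferences (overlap_pref \<delta> :: ('m, 3) preferences)"
    unfolding closed_preferences_def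
    using closed_divisions by (auto intro: closed_Collect_conj)
qed

lemma admissible_blocking_pref:
  assumes "CARD('m) \<ge> 3" "0 < \<epsilon>" "\<epsilon> \<le> 1 / 3"
  shows "admissible_preferences (blocking_pref \<epsilon> :: ('m::finite, 3) preferences)"
  unfolding admissible_preferences_def
proof (intro conjI ballI)
  fix x :: "('m, 3) division" assume "x \<in> divisions"
  then show "blocking_pref \<epsilon> x \<noteq> {}"
    using covering_selection_long_pieces[of x \<epsilon>] assms by (auto simp: blocking_pref_def)
next
  show "hungry (blocking_pref \<epsilon> :: ('m, 3) preferences)"
    using assms(2) by (auto simp: hungry_def blocking_pref_def intro: less_le_trans)
next
  have ex: "closed {x :: ('m, 3) division.
      \<exists>i j. right_end (x $ i) (s i) - left_end (x $ j) (s j) \<le> \<epsilon>}" for s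
    unfolding Collect_ex_eq
    by (intro closed_UN finite ballI closed_Collect_le continuous_intros)
  \<comment> \<open>The premise does not depend on \<open>x\<close>, so this set is everything or
    the set in \<open>ex\<close>.\<close>
  have "closed {x :: ('m, 3) division. disjoint_selections t s \<longrightarrow>
      (\<exists>i j. right_end (x $ i) (s i) - left_end (x $ j) (s j) \<le> \<epsilon>)}" for t s
    using ex by (cases "disjoint_selections t s") auto
  then have "closed {x :: ('m, 3) division. t \<in> blocking_pref \<epsilon> x}" for t
    unfolding blocking_pref_def mem_Collect_eq
    by (intro closed_Collect_conj closed_Collect_all closed_Collect_le continuous_intros)
  then show "closed_preferences (blocking_pref \<epsilon> :: ('m, 3) preferences)"
    unfolding closed_preferences_def
    using closed_divisions by (auto intro: closed_Collect_conj)
qed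

theorem theorem7:
  assumes "CARD('m::finite) \<ge> 3"
  shows "\<exists>Pref\<^sub>A Pref\<^sub>B :: ('m, 3) preferences.
           admissible_preferences Pref\<^sub>A \<and> admissible_preferences Pref\<^sub>B \<and>
           \<not> (\<exists>x\<in>divisions. \<exists>s\<^sub>A\<in>Pref\<^sub>A x. \<exists>s\<^sub>B\<in>Pref\<^sub>B x. disjoint_selections s\<^sub>A s\<^sub>B)"
proof -
  define \<delta> :: real where "\<delta> = (1 / 3) ^ CARD('m)"
  have pos: "0 < \<delta>" by (simp add: \<delta>_def)
  have "\<delta> \<le> (1 / 3) ^ 1"
    unfolding \<delta>_def using assms by (intro power_decreasing) auto
  then have small: "\<delta> / 2 \<le> 1 / 3" using pos by simp
  show ?thesis
  proof (intro exI conjI)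
    show "admissible_preferences (blocking_pref (\<delta> / 2) :: ('m, 3) preferences)"
      using admissible_blocking_pref[OF assms] pos small by simp
    show "admissible_preferences (overlap_pref \<delta> :: ('m, 3) preferences)"
      by (rule admissible_overlap_pref) (use pos in \<open>simp_all add: \<delta>_def\<close>)
    show "\<not> (\<exists>x\<in>divisions. \<exists>s\<^sub>A\<in>blocking_pref (\<delta> / 2) x. \<exists>s\<^sub>B\<in>overlap_pref \<delta> x.
             disjoint_selections s\<^sub>A (s\<^sub>B :: ('m, 3) selection))"
    proof clarify
      fix x :: "('m, 3) division" and t s
      assume "t \<in> blocking_pref (\<delta> / 2) x" "s \<in> overlap_pref \<delta> x" "disjoint_selections t s"
      then obtain i j where "right_end (x $ i) (s i) - left_end (x $ j) (s j) \<le> \<delta> / 2"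
        and "\<delta> \<le> right_end (x $ i) (s i) - left_end (x $ j) (s j)"
        unfolding blocking_pref_def overlap_pref_def by blast
      then show False using pos by linarith
    qed
  qed
qed

end
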